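(* For all integers $r\ge 1$ and $n\ge 0$, $$\beta_n^{(r)}=\sum_{k=0}^{n}\varphi_r(q,k)\,S_q(n,k),$$ where, for all integers $k\ge 0$, $$\varphi_r(q,k)=(-1)^k[k]!\sum_{i=0}^{r-1}q^{ik}\frac{[r-1]_i}{[k+r]_{i+1}}=(-1)^k[k]!\,[r-1]!\,q^{-r+1}\sum_{i=0}^{r-1}\frac{(q-1)^i\,q^{\frac12 i(i+1)-i(r-1)}}{[r-1-i]!}\,\frac{1}{[k+i+1]}$$ (in particular, the two expressions given for $\varphi_r(q,k)$ are equal).
   Context: Let $q$ be a positive real number, $q\neq 1$, and put $[X]:=\frac{q^X-1}{q-1}$. For an integer $k\ge 0$, $[X]_k:=[X][X-1]\cdots[X-k+1]$ (with $[X]_0=1$), and $[k]!:=[k]_k=[k][k-1]\cdots[1]$. The $q$-Stirling numbers of the second kind $S_q(n,k)$ ($n\ge k\ge 0$) are defined by the identities $$[X]^n=\sum_{k=0}^{n}q^{\frac12 k(k-1)}S_q(n,k)\,[X]_k\qquad(n\ge 0).$$ For integers $n\ge 0$ let $$\eta_n(X):=(q-1)^{-n}\sum_{k=0}^{n}(-1)^{n-k}\binom{n}{k}\frac{k}{[k]}\,q^{kX},$$ with the convention $\frac{k}{[k]}=1$ for $k=0$. The extended Carlitz $q$-Bernoulli polynomials $\beta_n^{(r)}(X)$ ($r,n\ge 0$ integers) are defined recursively by $\beta_n^{(0)}(X):=\eta_n(X)$ and $$\beta_n^{(r+1)}(X):=q^{-X}\left(\beta_n^{(r)}(X)+(q-1)\beta_{n+1}^{(r)}(X)\right),$$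 and $\beta_n^{(r)}:=\beta_n^{(r)}(0)$. *)

theory Defs
  imports Complex_Main
begin

definition qnum :: "real \<Rightarrow> real \<Rightarrow> real" where
  "qnum q X = (q powr X - 1) / (q - 1)"

definition qfalling :: "real \<Rightarrow> real \<Rightarrow> nat \<Rightarrow> real" where
  "qfalling q X k = (\<Prod>i<k. qnum q (X - real i))"

definition qfact :: "real \<Rightarrow> nat \<Rightarrow> real" where
  "qfact q k = qfalling q (real k) k"

text \<open>
  The defining identities of the \<open>q\<close>-Stirling numbers of the second kind, required for all real
  \<open>X\<close>. They only constrain the entries with \<open>k \<le> n\<close>; the remaining entries are set to \<open>0\<close>, so that
  for positive \<open>q \<noteq> 1\<close> exactly one array qualifies (\<open>qStirling2_ex1\<close> below).
\<close>

definition is_qStirling2 :: "real \<Rightarrow> (nat \<Rightarrow> nat \<Rightarrow> real) \<Rightarrow> bool" where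
  "is_qStirling2 q S \<longleftrightarrow>
     (\<forall>n X. qnum q X ^ n =
        (\<Sum>k=0..n. q powr (real k * (real k - 1) / 2) * S n k * qfalling q X k)) \<and>
     (\<forall>n k. n < k \<longrightarrow> S n k = 0)"

definition qStirling2 :: "real \<Rightarrow> nat \<Rightarrow> nat \<Rightarrow> real" where
  "qStirling2 q = (THE S. is_qStirling2 q S)"

text \<open>The quotient \<open>k / [k]\<close>, with its conventional value \<open>1\<close> at \<open>k = 0\<close>.\<close>

definition qratio :: "real \<Rightarrow> nat \<Rightarrow> real" where
  "qratio q k = (if k = 0 then 1 else real k / qnum q (real k))"

definition qeta :: "real \<Rightarrow> nat \<Rightarrow> real \<Rightarrow> real" where
  "qeta q n X = inverse ((q - 1) ^ n) *
     (\<Sum>k=0..n. (-1) ^ (n - k) * real (n choose k) * qratio q k * q powr (real k * X))"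

text \<open>\<open>qbeta q r n X\<close> is the extended Carlitz polynomial \<open>\<beta>\<^sub>n\<^sup>(\<^sup>r\<^sup>)(X)\<close>.\<close>

fun qbeta :: "real \<Rightarrow> nat \<Rightarrow> nat \<Rightarrow> real \<Rightarrow> real" where
  "qbeta q 0 n X = qeta q n X"
| "qbeta q (Suc r) n X = q powr (- X) * (qbeta q r n X + (q - 1) * qbeta q r (Suc n) X)"

definition qphi :: "real \<Rightarrow> nat \<Rightarrow> nat \<Rightarrow> real" where
  "qphi q r k = (-1) ^ k * qfact q k *
     (\<Sum>i=0..r-1. q ^ (i * k) * (qfalling q (real r - 1) i / qfalling q (real k + real r) (i + 1)))"


lemma qnum_eq_0_iff:
  assumes "q > 0" "q \<noteq> 1"
  shows "qnum q X = 0 \<longleftrightarrow> X = 0"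
  using assms by (auto simp: qnum_def powr_def)

lemma qnum_split:
  assumes "q > 0" "q \<noteq> 1"
  shows "qnum q X = qnum q (real k) + q powr real k * qnum q (X - real k)"
proof -
  have "q powr real k * q powr (X - real k) = q powr X"
    by (simp flip: powr_add)
  then show ?thesis
    unfolding qnum_def times_divide_eq_right add_divide_distrib[symmetric]
    by (simp add: algebra_simps)
qed

lemma qfalling_nat_eq_0:
  assumes "q > 0" "j < k"
  shows "qfalling q (real j) k = 0"
  using assms unfolding qfalling_def
  by (intro prod_zero) (auto intro!: bexI[of _ j] simp: qnum_def powr_def)

lemma qfalling_nat_diag:
  assumes "q > 0" "q \<noteq> 1"
  shows "qfalling q (real j) j \<noteq> 0"
  using assms by (auto simp: qfalling_def qnum_eq_0_iff)

fun qStirling2_rec :: "real \<Rightarrow> nat \<Rightarrow> nat \<Rightarrow> real" where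
  "qStirling2_rec q 0 k = (if k = 0 then 1 else 0)"
| "qStirling2_rec q (Suc n) k =
     (if k = 0 then 0 else qStirling2_rec q n (k - 1)) + qnum q (real k) * qStirling2_rec q n k"

lemma qStirling2_rec_eq_0: "n < k \<Longrightarrow> qStirling2_rec q n k = 0"
  by (induction n arbitrary: k) auto

lemma is_qStirling2_rec:
  assumes q: "q > 0" "q \<noteq> 1"
  shows "is_qStirling2 q (qStirling2_rec q)"
proof -
  define e where "e k = q powr (real k * (real k - 1) / 2)" for k :: nat
  have e_Suc: "e (Suc k) = e k * q powr real k" for k
    by (simp add: e_def field_simps flip: powr_add)
  have "qnum q X ^ n = (\<Sum>k=0..n. e k * qStirling2_rec q n k * qfalling q X k)" for n X
  proof (induction n)
    case 0
    then show ?case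
      using q by (simp add: e_def qfalling_def)
  next
    case (Suc n)
    let ?S = "qStirling2_rec q n" and ?F = "qfalling q X"
    have F_Suc: "?F (Suc k) = ?F k * qnum q (X - real k)" for k
      by (simp add: qfalling_def)
    have "qnum q X ^ Suc n = (\<Sum>k=0..n. e k * ?S k * ?F k * qnum q X)"
      unfolding power_Suc2 Suc.IH sum_distrib_right ..
    also have "\<dots> = (\<Sum>k=0..n. e k * qnum q (real k) * ?S k * ?F k + e (Suc k) * ?S k * ?F (Suc k))"
    proof (rule sum.cong[OF refl])
      fix k
      show "e k * ?S k * ?F k * qnum q X =
            e k * qnum q (real k) * ?S k * ?F k + e (Suc k) * ?S k * ?F (Suc k)"
        by (subst qnum_split[OF q, of X k]) (simp add: e_Suc F_Suc algebra_simps)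
    qed
    also have "\<dots> = (\<Sum>k=0..Suc n. e k * qnum q (real k) * ?S k * ?F k) +
                    (\<Sum>k=0..n. e (Suc k) * ?S k * ?F (Suc k))"
      by (simp add: sum.distrib qStirling2_rec_eq_0)
    also have "(\<Sum>k=0..n. e (Suc k) * ?S k * ?F (Suc k)) =
               (\<Sum>k=0..Suc n. e k * (if k = 0 then 0 else ?S (k - 1)) * ?F k)"
      by (subst sum.atLeast0_atMost_Suc_shift) simp
    finally show ?case
      by (simp only: qStirling2_rec.simps sum.distrib[symmetric]) (simp add: algebra_simps)
  qed
  then show ?thesis
    by (simp add: is_qStirling2_def e_def qStirling2_rec_eq_0)
qed

lemma is_qStirling2_unique:
  assumes q: "q > 0" "q \<noteq> 1" and S: "is_qStirling2 q S" and T: "is_qStirling2 q T"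
  shows "S = T"
proof (intro ext)
  fix n k
  define c where "c k = q powr (real k * (real k - 1) / 2)" for k :: nat
  have eq: "(\<Sum>k=0..n. c k * (S n k - T n k) * qfalling q X k) = 0" for X
  proof -
    have "(\<Sum>k=0..n. c k * S n k * qfalling q X k) = (\<Sum>k=0..n. c k * T n k * qfalling q X k)"
      using S T unfolding is_qStirling2_def c_def by metis
    then show ?thesis
      by (simp add: algebra_simps sum_subtractf)
  qed
  show "S n k = T n k"
  proof (cases "k \<le> n")
    case False
    then show ?thesis
      using S T by (simp add: is_qStirling2_def)
  next
    case True
    then show ?thesis
    proof (induction k rule: less_induct)
      case (less k)
      have "(\<Sum>j=0..n. c j * (S n j - T n j) * qfalling q (real k) j) =
            (\<Sum>j\<in>{k}. c j * (S n j - T n j) * qfalling q (real k) j)"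
      proof (rule sum.mono_neutral_right)
        show "\<forall>j\<in>{0..n} - {k}. c j * (S n j - T n j) * qfalling q (real k) j = 0"
        proof
          fix j
          assume j: "j \<in> {0..n} - {k}"
          then consider "j < k" | "k < j"
            by fastforce
          then show "c j * (S n j - T n j) * qfalling q (real k) j = 0"
            using less.IH[of j] j q by cases (auto simp: qfalling_nat_eq_0)
        qed
      qed (use less.prems in auto)
      then have "c k * (S n k - T n k) * qfalling q (real k) k = 0"
        using eq[of "real k"] by simp
      then show ?case
        using q qfalling_nat_diag[OF q, of k] by (simp add: c_def)
    qed
  qed
qed

lemma qStirling2_ex1:
  assumes "q > 0" "q \<noteq> 1"
  shows "\<exists>!S. is_qStirling2 q S"
  using is_qStirling2_rec[OF assms] is_qStirling2_unique[OF assms] by blast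

lemma is_qStirling2_qStirling2:
  assumes "q > 0" "q \<noteq> 1"
  shows "is_qStirling2 q (qStirling2 q)"
  unfolding qStirling2_def by (rule theI'[OF qStirling2_ex1[OF assms]])

end

theory Submission
  imports Defs "HOL-Computational_Algebra.Polynomial"
begin

text \<open>
  Let \<open>L\<close> be the linear functional on polynomials in \<open>T = q\<^sup>X\<close> with \<open>L (T\<^sup>m) = m / [m]\<close>. Then
  \<open>\<eta>\<^sub>n(0) = L ([X]\<^sup>n)\<close>, and since \<open>1 + (q - 1) [X] = T\<close>, also \<open>\<beta>\<^sub>n\<^sup>(\<^sup>1\<^sup>) = L (T [X]\<^sup>n)\<close>. The identity
  \<open>L (f(q T)) - L (f(T)) = (q - 1) f'(1)\<close>, applied to \<open>f = \<Prod>i\<le>k. (T - q\<^sup>i)\<close>, evaluates \<open>L\<close> on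
  \<open>T [X]\<^sub>k\<close> and settles \<open>r = 1\<close>. Passing from \<open>r\<close> to \<open>r + 1\<close> amounts to
  \<open>\<phi>\<^sub>r\<^sub>+\<^sub>1(k) = q\<^sup>k \<phi>\<^sub>r(k) + (q - 1) \<phi>\<^sub>r(k + 1)\<close>, which both expressions for \<open>\<phi>\<^sub>r\<close> satisfy.
\<close>

section \<open>Elementary facts about q-numbers and q-factorials\<close>

lemma qnum_of_nat: "q > 0 \<Longrightarrow> qnum q (real n) = (q ^ n - 1) / (q - 1)"
  by (simp add: qnum_def powr_realpow)

lemma qnum_of_nat_eq_0_iff:
  "q > 0 \<Longrightarrow> q \<noteq> 1 \<Longrightarrow> qnum q (real n) = 0 \<longleftrightarrow> n = 0"
  by (simp add: qnum_eq_0_iff)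

lemma power_eq_1_iff_of_pos:
  fixes q :: real
  assumes "q > 0" "q \<noteq> 1"
  shows "q ^ n = 1 \<longleftrightarrow> n = 0"
  using qnum_of_nat_eq_0_iff[OF assms, of n] assms by (simp add: qnum_of_nat)

lemma qfalling_0 [simp]: "qfalling q X 0 = 1"
  by (simp add: qfalling_def)

lemma qfalling_Suc: "qfalling q X (Suc k) = qnum q X * qfalling q (X - 1) k"
  unfolding qfalling_def prod.lessThan_Suc_shift by (simp add: algebra_simps)

lemma qfact_0 [simp]: "qfact q 0 = 1"
  by (simp add: qfact_def)

lemma qfact_Suc: "qfact q (Suc k) = qnum q (real (Suc k)) * qfact q k"
  unfolding qfact_def qfalling_Suc by simp

lemma qfact_nonzero: "q > 0 \<Longrightarrow> q \<noteq> 1 \<Longrightarrow> qfact q k \<noteq> 0"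
  unfolding qfact_def by (rule qfalling_nat_diag)

lemma qStirling2_eq_rec:
  assumes "q > 0" "q \<noteq> 1"
  shows "qStirling2 q = qStirling2_rec q"
  using is_qStirling2_unique[OF assms is_qStirling2_qStirling2[OF assms] is_qStirling2_rec[OF assms]] .


section \<open>The functional representing the Carlitz numbers\<close>

definition qfunctional :: "real \<Rightarrow> real poly \<Rightarrow> real" where
  "qfunctional q p = (\<Sum>i\<le>degree p. coeff p i * qratio q i)"

lemma qfunctional_altdef:
  assumes "degree p \<le> N"
  shows "qfunctional q p = (\<Sum>i\<le>N. coeff p i * qratio q i)"
  unfolding qfunctional_def
  by (rule sum.mono_neutral_left) (use assms in \<open>auto simp: coeff_eq_0\<close>)

lemma qfunctional_add: "qfunctional q (p + r) = qfunctional q p + qfunctional q r"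
proof -
  define N where "N = max (degree p) (degree r)"
  have "degree (p + r) \<le> N" "degree p \<le> N" "degree r \<le> N"
    by (auto simp: N_def degree_add_le_max)
  then show ?thesis
    by (simp add: qfunctional_altdef sum.distrib distrib_right)
qed

lemma qfunctional_smult: "qfunctional q (smult c p) = c * qfunctional q p"
  by (simp add: qfunctional_altdef[OF degree_smult_le] qfunctional_def sum_distrib_left mult.assoc)

lemma qfunctional_sum: "qfunctional q (\<Sum>i\<in>A. f i) = (\<Sum>i\<in>A. qfunctional q (f i))"
proof (induction A rule: infinite_finite_induct)
  case (insert x A)
  then show ?case by (simp add: qfunctional_add)
qed (simp_all add: qfunctional_def)

lemma qfunctional_monom: "qfunctional q (monom c n) = c * qratio q n"
  by (simp add: qfunctional_altdef[OF degree_monom_le] if_distrib[of "\<lambda>x. x * _"] cong: if_cong)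

text \<open>For \<open>n > 0\<close> this is the definition of \<open>[n]\<close>; at
  \<open>n = 0\<close> both sides vanish, whatever the conventional value of
  \<open>qratio q 0\<close>.\<close>

lemma qratio_dilate:
  assumes "q > 0" "q \<noteq> 1"
  shows "qratio q n * (q ^ n - 1) = (q - 1) * real n"
  using assms by (simp add: qratio_def qnum_of_nat power_eq_1_iff_of_pos)

text \<open>By linearity it suffices to treat \<open>T^n\<close>: dilation multiplies it by
  \<open>q^n\<close>, and \<open>qratio_dilate\<close> turns the resulting factor
  \<open>q^n - 1\<close> into \<open>(q - 1) n\<close>, where \<open>n\<close> is the derivative of
  \<open>T^n\<close> at \<open>1\<close>.\<close>

lemma qfunctional_dilate:
  assumes q: "q > 0" "q \<noteq> 1"
  shows "qfunctional q (p \<circ>\<^sub>p [:0, q:]) - qfunctional q p = (q - 1) * poly (pderiv p) 1"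
proof -
  let ?m = "\<lambda>i. monom (coeff p i) i" and ?I = "{..degree p}"
  have dilate: "monom c n \<circ>\<^sub>p [:0, q:] = monom (c * q ^ n) n" for c n
    by (simp add: poly_pcompose poly_monom power_mult_distrib fun_eq_iff flip: poly_eq_poly_eq_iff)
  have *: "qfunctional q (monom c n \<circ>\<^sub>p [:0, q:]) - qfunctional q (monom c n) =
      (q - 1) * poly (pderiv (monom c n)) 1" for c n
  proof -
    have "qfunctional q (monom c n \<circ>\<^sub>p [:0, q:]) - qfunctional q (monom c n) =
        c * (qratio q n * (q ^ n - 1))"
      by (simp add: dilate qfunctional_monom algebra_simps)
    then show ?thesis
      by (simp add: qratio_dilate[OF q] pderiv_monom poly_monom)
  qed
  have "qfunctional q (sum ?m ?I \<circ>\<^sub>p [:0, q:]) - qfunctional q (sum ?m ?I) =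
      (\<Sum>i\<in>?I. (q - 1) * poly (pderiv (?m i)) 1)"
    by (simp only: pcompose_sum qfunctional_sum flip: sum_subtractf) (simp only: *)
  also have "\<dots> = (q - 1) * poly (pderiv (sum ?m ?I)) 1"
    using higher_pderiv_sum[of 1 ?m ?I] by (simp add: poly_sum sum_distrib_left)
  finally show ?thesis
    by (simp only: poly_as_sum_of_monoms)
qed

section \<open>Falling factorials as polynomials in \<open>T\<close>, and the value of
  \<open>L\<close> on them\<close>

text \<open>In terms of \<open>T = q\<^sup>X\<close>, this is \<open>q\<^bsup>k(k-1)/2\<^esup> (q - 1)\<^sup>k [X]\<^sub>k\<close>.\<close>

definition qfalling_poly :: "real \<Rightarrow> nat \<Rightarrow> real poly" where
  "qfalling_poly q k = (\<Prod>i<k. [:- (q ^ i), 1:])"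

lemma qfalling_poly_0 [simp]: "qfalling_poly q 0 = 1"
  by (simp add: qfalling_poly_def)

lemma qfalling_poly_Suc: "qfalling_poly q (Suc k) = qfalling_poly q k * [:- (q ^ k), 1:]"
  by (simp add: qfalling_poly_def)

text \<open>Substituting \<open>q T\<close> turns \<open>T - q^(i+1)\<close> into
  \<open>q (T - q^i)\<close>, so each factor becomes a multiple of its predecessor; only
  \<open>T - 1\<close> becomes the new factor \<open>q T - 1\<close>.\<close>

lemma qfalling_poly_Suc_dilate:
  "qfalling_poly q (Suc k) \<circ>\<^sub>p [:0, q:] = smult (q ^ k) (qfalling_poly q k * [:- 1, q:])"
proof (induction k)
  case 0
  then show ?case by (simp add: qfalling_poly_Suc pcompose_pCons)
next
  case (Suc k)
  have "[:- (q ^ Suc k), 1:] \<circ>\<^sub>p [:0, q:] = smult q [:- (q ^ k), 1:]"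
    by (simp add: pcompose_pCons)
  then have "qfalling_poly q (Suc (Suc k)) \<circ>\<^sub>p [:0, q:] =
      smult (q ^ k) (qfalling_poly q k * [:- 1, q:]) * smult q [:- (q ^ k), 1:]"
    by (simp only: qfalling_poly_Suc[of q "Suc k"] pcompose_mult Suc.IH)
  also have "\<dots> = smult (q ^ Suc k) (qfalling_poly q (Suc k) * [:- 1, q:])"
    unfolding qfalling_poly_Suc mult_smult_left mult_smult_right smult_smult
    by (simp only: mult_ac power_Suc)
  finally show ?case .
qed

text \<open>The factor with \<open>i = 0\<close> vanishes at \<open>1\<close>, so the derivative
  there is the product of the other factors \<open>1 - q^i = -(q - 1) [i]\<close>, for
  \<open>i\<close> from \<open>1\<close> to \<open>k\<close>.\<close>

lemma poly_pderiv_qfalling_poly_1: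
  assumes q: "q > 0" "q \<noteq> 1"
  shows "poly (pderiv (qfalling_poly q (Suc k))) 1 = (- 1) ^ k * (q - 1) ^ k * qfact q k"
proof -
  have root: "poly (qfalling_poly q (Suc k)) 1 = 0" for k
    by (induction k) (simp_all add: qfalling_poly_Suc)
  show ?thesis
  proof (induction k)
    case 0
    then show ?case by (simp add: qfalling_poly_Suc pderiv_pCons)
  next
    case (Suc k)
    have "poly (pderiv (qfalling_poly q (Suc (Suc k)))) 1 =
        poly (pderiv (qfalling_poly q (Suc k))) 1 * (1 - q ^ Suc k)"
      using root[of k] unfolding qfalling_poly_Suc[of q "Suc k"] pderiv_mult
      by (simp add: pderiv_pCons algebra_simps)
    also have "1 - q ^ Suc k = - ((q - 1) * qnum q (real (Suc k)))"
      using q by (simp add: qnum_of_nat del: of_nat_Suc)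
    finally show ?case
      by (simp add: Suc.IH qfact_Suc del: of_nat_Suc)
  qed
qed

text \<open>Dilation changes \<open>?P (Suc k)\<close> by exactly
  \<open>(q^(k+1) - 1) T ?P k\<close>, so \<open>qfunctional_dilate\<close> expresses the value
  sought through the derivative at \<open>1\<close>.\<close>

lemma qfunctional_shifted_qfalling_poly:
  assumes q: "q > 0" "q \<noteq> 1"
  shows "qfunctional q ([:0, 1:] * qfalling_poly q k) =
    (q - 1) ^ k * ((- 1) ^ k * qfact q k / qnum q (real (Suc k)))"
proof -
  let ?P = "qfalling_poly q"
  have "?P (Suc k) \<circ>\<^sub>p [:0, q:] = ?P (Suc k) + smult (q ^ Suc k - 1) ([:0, 1:] * ?P k)"
  proof -
    \<comment> \<open>\<open>q^k (q T - 1)\<close> and \<open>T - q^k\<close> have the same constant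
      term, so they differ by a multiple of \<open>T\<close>.\<close>
    have "smult (q ^ k) [:- 1, q:] = [:- (q ^ k), 1:] + smult (q ^ Suc k - 1) [:0, 1:]"
      by simp
    then have "?P k * smult (q ^ k) [:- 1, q:] =
        ?P k * [:- (q ^ k), 1:] + ?P k * smult (q ^ Suc k - 1) [:0, 1:]"
      by (simp only: distrib_left)
    then show ?thesis
      unfolding qfalling_poly_Suc_dilate unfolding qfalling_poly_Suc mult_smult_right
      by (simp only: mult.commute)
  qed
  then have "(q ^ Suc k - 1) * qfunctional q ([:0, 1:] * ?P k) =
      (q - 1) * ((- 1) ^ k * (q - 1) ^ k * qfact q k)"
    using qfunctional_dilate[OF q, of "?P (Suc k)"]
    by (simp only: qfunctional_add qfunctional_smult poly_pderiv_qfalling_poly_1[OF q] add_diff_cancel_left')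
  moreover have "q ^ Suc k - 1 \<noteq> 0"
    using power_eq_1_iff_of_pos[OF q, of "Suc k"] by simp
  moreover have qnum: "qnum q (real (Suc k)) = (q ^ Suc k - 1) / (q - 1)"
    using q by (simp only: qnum_of_nat)
  ultimately have "qfunctional q ([:0, 1:] * ?P k) =
      (q - 1) * ((- 1) ^ k * (q - 1) ^ k * qfact q k) / (q ^ Suc k - 1)"
    by (simp only: nonzero_eq_divide_eq mult_ac not_False_eq_True)
  with qnum show ?thesis
    by (simp only: mult_ac times_divide_eq_right divide_divide_eq_right)
qed

section \<open>Powers of \<open>[X]\<close> in the monomial and falling bases, and the case
  \<open>r = 1\<close>\<close>

text \<open>\<open>[X]\<close> as a polynomial in \<open>T\<close>.\<close>

definition qnum_poly :: "real \<Rightarrow> real poly" where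
  "qnum_poly q = [:- 1 / (q - 1), 1 / (q - 1):]"

lemma qnum_poly_power_eq_binomial:
  "qnum_poly q ^ n =
    (\<Sum>k\<le>n. monom (inverse ((q - 1) ^ n) * ((- 1) ^ (n - k) * real (n choose k))) k)"
proof -
  have "qnum_poly q = smult (inverse (q - 1)) (monom 1 1 + [:- 1:])"
    by (simp add: qnum_poly_def monom_altdef divide_inverse)
  then have "qnum_poly q ^ n = smult (inverse ((q - 1) ^ n)) ((monom 1 1 + [:- 1:]) ^ n)"
    by (simp add: smult_power power_inverse)
  also have "(monom 1 1 + [:- 1:]) ^ n =
      (\<Sum>k\<le>n. monom ((- 1) ^ (n - k) * real (n choose k)) k)"
    unfolding binomial_ring
    by (intro sum.cong refl)
       (simp add: monom_power poly_const_pow of_nat_poly mult_ac smult_monom)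
  finally show ?thesis
    by (simp add: fun_eq_iff poly_sum poly_monom sum_distrib_left mult_ac flip: poly_eq_poly_eq_iff)
qed

lemma qeta_0_eq_qfunctional: "q > 0 \<Longrightarrow> qeta q n 0 = qfunctional q (qnum_poly q ^ n)"
  unfolding qnum_poly_power_eq_binomial qfunctional_sum qfunctional_monom qeta_def
  by (simp add: sum_distrib_left atLeast0AtMost mult_ac)

lemma qbeta_1_eq_qfunctional:
  assumes q: "q > 0" "q \<noteq> 1"
  shows "qbeta q 1 n 0 = qfunctional q ([:0, 1:] * qnum_poly q ^ n)"
proof -
  have T: "[:0, 1:] = 1 + smult (q - 1) (qnum_poly q)"
    using q by (simp add: qnum_poly_def one_pCons)
  have "[:0, 1:] * qnum_poly q ^ n = qnum_poly q ^ n + smult (q - 1) (qnum_poly q ^ Suc n)"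
    unfolding T distrib_right by simp
  then show ?thesis
    using q by (simp add: qeta_0_eq_qfunctional qfunctional_add qfunctional_smult)
qed

text \<open>Moves the Stirling recursion from the array onto the weights \<open>f\<close>. With
  basis polynomials as weights it describes multiplication by \<open>[X]\<close>; with
  \<open>qphi\<close> as weights it serves the step from \<open>r\<close> to
  \<open>r + 1\<close>.\<close>

lemma sum_qStirling2_rec_Suc:
  fixes f :: "nat \<Rightarrow> real"
  shows "(\<Sum>k=0..Suc n. f k * qStirling2_rec q (Suc n) k) =
    (\<Sum>k=0..n. (f (Suc k) + qnum q (real k) * f k) * qStirling2_rec q n k)"
proof -
  let ?S = "qStirling2_rec q"
  have "(\<Sum>k=0..Suc n. f k * ?S (Suc n) k) =
      (\<Sum>k=0..Suc n. f k * (if k = 0 then 0 else ?S n (k - 1))) +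
      (\<Sum>k=0..Suc n. qnum q (real k) * f k * ?S n k)"
    by (simp only: qStirling2_rec.simps sum.distrib[symmetric]) (simp only: distrib_left mult_ac)
  also have "(\<Sum>k=0..Suc n. f k * (if k = 0 then 0 else ?S n (k - 1))) =
      (\<Sum>k=0..n. f (Suc k) * ?S n k)"
    by (subst sum.atLeast0_atMost_Suc_shift) simp
  also have "(\<Sum>k=0..Suc n. qnum q (real k) * f k * ?S n k) =
      (\<Sum>k=0..n. qnum q (real k) * f k * ?S n k)"
    by (simp add: qStirling2_rec_eq_0)
  finally show ?thesis
    by (simp add: sum.distrib distrib_right)
qed

text \<open>The identity is shown by induction at every real \<open>x\<close>, not only at
  \<open>x = q^X\<close>; polynomials that agree as functions are equal.\<close>

lemma qnum_poly_power_eq_qStirling2_rec: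
  assumes q: "q > 0" "q \<noteq> 1"
  shows "qnum_poly q ^ n =
    (\<Sum>k=0..n. smult (qStirling2_rec q n k) (smult (inverse ((q - 1) ^ k)) (qfalling_poly q k)))"
proof -
  have "((x - 1) / (q - 1)) ^ n =
      (\<Sum>k=0..n. poly (qfalling_poly q k) x / (q - 1) ^ k * qStirling2_rec q n k)" for x
  proof (induction n)
    case (Suc n)
    define f where "f k = poly (qfalling_poly q k) x / (q - 1) ^ k" for k
    \<comment> \<open>Split \<open>x - 1 = (x - q^k) + (q^k - 1)\<close>: the first part extends the
      product, the second gives \<open>[k]\<close>.\<close>
    have "f (Suc k) + qnum q (real k) * f k = (x - 1) / (q - 1) * f k" for k
    proof -
      have "f (Suc k) = f k * ((x - q ^ k) / (q - 1))"
        by (simp add: f_def qfalling_poly_Suc field_simps)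
      then show ?thesis
        using q by (simp add: qnum_of_nat field_simps)
    qed
    then show ?case
      using Suc.IH unfolding f_def[symmetric]
      by (simp only: sum_qStirling2_rec_Suc power_Suc sum_distrib_left mult.assoc)
  qed simp
  moreover have "poly (qnum_poly q) x = (x - 1) / (q - 1)" for x
    by (simp add: qnum_poly_def diff_divide_distrib)
  ultimately show ?thesis
    by (simp add: fun_eq_iff poly_sum divide_inverse mult_ac flip: poly_eq_poly_eq_iff)
qed

lemma qbeta_1_eq_sum_qStirling2_rec:
  assumes q: "q > 0" "q \<noteq> 1"
  shows "qbeta q 1 n 0 =
    (\<Sum>k=0..n. (- 1) ^ k * qfact q k / qnum q (real (Suc k)) * qStirling2_rec q n k)"
proof -
  have "qbeta q 1 n 0 = (\<Sum>k=0..n. qStirling2_rec q n k * (inverse ((q - 1) ^ k) *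
      qfunctional q ([:0, 1:] * qfalling_poly q k)))"
    unfolding qbeta_1_eq_qfunctional[OF q] qnum_poly_power_eq_qStirling2_rec[OF q] sum_distrib_left
    by (simp only: qfunctional_sum mult_smult_right qfunctional_smult)
  then show ?thesis
    unfolding qfunctional_shifted_qfalling_poly[OF q]
    using q by (simp add: field_simps del: of_nat_Suc)
qed


section \<open>The coefficients\<close>

text \<open>Here \<open>s\<close> stands for \<open>r - 1\<close>, and the prefactor
  \<open>(-1)^k [k]!\<close> of \<open>qphi\<close> is left out.\<close>

definition qphi_sum :: "real \<Rightarrow> nat \<Rightarrow> nat \<Rightarrow> real" where
  "qphi_sum q s k =
    (\<Sum>i=0..s. q ^ (i * k) * (qfalling q (real s) i / qfalling q (real k + real s + 1) (i + 1)))"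

lemma qphi_Suc: "qphi q (Suc s) k = (- 1) ^ k * qfact q k * qphi_sum q s k"
  by (simp add: qphi_def qphi_sum_def add_ac)

lemma qphi_sum_0: "qphi_sum q 0 k = 1 / qnum q (real (Suc k))"
  by (simp add: qphi_sum_def qfalling_Suc add.commute)

text \<open>Every denominator \<open>[k+s+2]_(i+1)\<close> starts with \<open>[k+s+2]\<close>. Once
  this is cancelled, the term \<open>i = 0\<close> is \<open>1\<close>, and the others are the terms
  of order \<open>s\<close> times \<open>q^k [s+1]\<close>.\<close>

lemma qphi_sum_Suc:
  assumes q: "q > 0" "q \<noteq> 1"
  shows "qnum q (real (k + s + 2)) * qphi_sum q (Suc s) k =
    1 + q ^ k * qnum q (real (Suc s)) * qphi_sum q s k"
proof -
  let ?N = "qnum q (real (k + s + 2))"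
  have N: "?N \<noteq> 0"
    using q by (simp add: qnum_eq_0_iff)
  have shift: "qfalling q (real k + real (Suc s) + 1) (i + 1) =
      ?N * qfalling q (real k + real s + 1) i" for i
    by (simp add: qfalling_Suc add_ac)
  have "?N * qphi_sum q (Suc s) k =
      (\<Sum>i=0..Suc s. q ^ (i * k) * (qfalling q (real (Suc s)) i / qfalling q (real k + real s + 1) i))"
    unfolding qphi_sum_def shift sum_distrib_left
    by (intro sum.cong refl) (use N in simp)
  also have "\<dots> = 1 + (\<Sum>i=0..s. q ^ k * qnum q (real (Suc s)) *
      (q ^ (i * k) * (qfalling q (real s) i / qfalling q (real k + real s + 1) (i + 1))))"
    by (subst sum.atLeast0_atMost_Suc_shift)
       (simp add: qfalling_Suc[of q "real (Suc s)"] power_add del: of_nat_Suc, simp add: mult_ac)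
  finally show ?thesis
    by (simp only: qphi_sum_def sum_distrib_left)
qed

text \<open>Induction on \<open>s\<close> with the claim multiplied by \<open>[k+s+2]\<close>, the
  leading denominator of \<open>qphi_sum q (Suc s) k\<close> and
  \<open>qphi_sum q s (Suc k)\<close>. The remaining \<open>qphi_sum q s k\<close> is treated by
  \<open>[m+1] = 1 + q [m]\<close>.\<close>

lemma qphi_sum_recurrence:
  assumes q: "q > 0" "q \<noteq> 1"
  shows "qphi_sum q (Suc s) k = q ^ k * qphi_sum q s k - (q ^ Suc k - 1) * qphi_sum q s (Suc k)"
proof (induction s arbitrary: k)
  case 0
  let ?a = "qnum q (real (Suc k))" and ?b = "qnum q (real (k + 0 + 2))"
  have nz: "?a \<noteq> 0" "?b \<noteq> 0"
    using q by (simp_all add: qnum_eq_0_iff)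
  have b: "?b = 1 + q * ?a"
    using q by (simp add: qnum_of_nat field_simps del: of_nat_Suc of_nat_add)
  have "qphi_sum q 0 (Suc k) = 1 / ?b"
    by (simp add: qphi_sum_0)
  then have 1: "?b * qphi_sum q 0 (Suc k) = 1"
    using nz by simp
  have 0: "?a * qphi_sum q 0 k = 1"
    using nz by (simp add: qphi_sum_0 del: of_nat_Suc)
  have "qnum q (real (Suc 0)) = 1"
    using q by (simp add: qnum_def)
  then have "?b * qphi_sum q (Suc 0) k = 1 + q ^ k * qphi_sum q 0 k"
    using qphi_sum_Suc[OF q, of k 0] by simp
  also have "\<dots> = ?b * (q ^ k * qphi_sum q 0 k - (q ^ Suc k - 1) * qphi_sum q 0 (Suc k))"
  proof -
    have "?b * qphi_sum q 0 k = qphi_sum q 0 k + q"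
      unfolding b distrib_right mult.assoc 0 by simp
    then have "?b * (q ^ k * qphi_sum q 0 k - (q ^ Suc k - 1) * qphi_sum q 0 (Suc k)) =
        q ^ k * (qphi_sum q 0 k + q) - (q ^ Suc k - 1) * 1"
      unfolding right_diff_distrib mult.left_commute[of ?b] 1 by (simp only:)
    then show ?thesis
      by (simp add: algebra_simps)
  qed
  finally show ?case
    by (rule mult_left_cancel[OF nz(2), THEN iffD1])
next
  case (Suc s)
  let ?b = "qnum q (real (k + Suc s + 2))" and ?c = "qnum q (real (k + s + 2))"
  have nz: "?b \<noteq> 0"
    using q by (simp add: qnum_eq_0_iff)
  \<comment> \<open>\<open>?c\<close> is the leading denominator of
    \<open>qphi_sum q (Suc s) k\<close>, so multiplying that sum by \<open>?b\<close> passes through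
    this relation.\<close>
  have b: "?b = 1 + q * ?c"
    and u: "qnum q (real (Suc (Suc s))) = 1 + q * qnum q (real (Suc s))"
    using q by (simp_all add: qnum_of_nat field_simps del: of_nat_Suc of_nat_add)
  have A1: "?b * qphi_sum q (Suc s) (Suc k) =
      1 + (q * q ^ k) * qnum q (real (Suc s)) * qphi_sum q s (Suc k)"
    using qphi_sum_Suc[OF q, of "Suc k" s] by (simp del: of_nat_Suc of_nat_add)
  have "?b * qphi_sum q (Suc (Suc s)) k =
      1 + q ^ k * qnum q (real (Suc (Suc s))) * qphi_sum q (Suc s) k"
    by (rule qphi_sum_Suc[OF q])
  also have "\<dots> = ?b * (q ^ k * qphi_sum q (Suc s) k - (q ^ Suc k - 1) * qphi_sum q (Suc s) (Suc k))"
  proof -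
    let ?x = "q ^ k" and ?v = "qnum q (real (Suc s))"
    let ?A = "qphi_sum q (Suc s) k" and ?B = "qphi_sum q s k" and ?B1 = "qphi_sum q s (Suc k)"
    have "?b * ?A = ?A + q * (1 + ?x * ?v * ?B)"
      unfolding b distrib_right mult.assoc qphi_sum_Suc[OF q] by simp
    then have "?b * (?x * ?A - (q ^ Suc k - 1) * qphi_sum q (Suc s) (Suc k)) =
        ?x * (?A + q * (1 + ?x * ?v * ?B)) - (q * ?x - 1) * (1 + (q * ?x) * ?v * ?B1)"
      unfolding right_diff_distrib mult.left_commute[of ?b] A1 by (simp only: power_Suc)
    also have "\<dots> = 1 + ?x * ?A + q * ?x * ?v * (?x * ?B - (q ^ Suc k - 1) * ?B1)"
      by (simp add: algebra_simps)
    also have "\<dots> = 1 + ?x * ?A + q * ?x * ?v * ?A"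
      by (simp only: Suc.IH)
    finally show ?thesis
      unfolding u by (simp only: distrib_left distrib_right mult_1_right mult_ac add_ac)
  qed
  finally show ?case
    by (rule mult_left_cancel[OF nz, THEN iffD1])
qed

section \<open>Partial fractions: the second expression for the coefficients\<close>

text \<open>The coefficients of the partial fraction expansion of \<open>qphi_sum\<close>, up to \<open>q\<^sup>-\<^sup>s\<close>.\<close>

definition qphi_coeff :: "real \<Rightarrow> nat \<Rightarrow> nat \<Rightarrow> real" where
  "qphi_coeff q s i = (\<Prod>j<i. q - q powr (real j + 1 - real s))"

text \<open>The factor with \<open>j = s\<close> is \<open>q - q\<close>.\<close>

lemma qphi_coeff_eq_0: "q > 0 \<Longrightarrow> s < i \<Longrightarrow> qphi_coeff q s i = 0"
  unfolding qphi_coeff_def by (rule prod_zero) (auto intro!: bexI[of _ s])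

lemma qphi_coeff_Suc_Suc:
  "qphi_coeff q (Suc s) (Suc i) = (q - q powr (- real s)) * qphi_coeff q s i"
  unfolding qphi_coeff_def prod.lessThan_Suc_shift by (simp add: algebra_simps)

lemma qphi_coeff_Suc:
  "qphi_coeff q s (Suc i) = qphi_coeff q s i * (q - q powr (real i + 1 - real s))"
  by (simp add: qphi_coeff_def)

text \<open>Splitting off the first factor on the left and the last on the right makes both sides
  multiples of \<open>qphi_coeff q s i\<close>. What remains is
  \<open>q - q^(-s) = (q - q^(i+1-s)) / q^(i+1) + q - q^(-i)\<close>.\<close>

lemma qphi_coeff_recurrence:
  assumes q: "q > 0"
  shows "qphi_coeff q (Suc s) (Suc i) =
    qphi_coeff q s (Suc i) / q ^ Suc i + (q - 1 / q ^ i) * qphi_coeff q s i"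
proof -
  have powr: "q powr (real i + 1 - real s) = q ^ Suc i * q powr (- real s)"
    using q powr_add[of q "real (Suc i)" "- real s"]
    by (simp only: powr_realpow) (simp add: algebra_simps)
  show ?thesis
    unfolding qphi_coeff_Suc_Suc unfolding qphi_coeff_Suc powr
    using q by (simp add: field_simps)
qed

text \<open>Raising \<open>i\<close> by one multiplies the left side by
  \<open>(q - 1) q^(i+1-s) [s-i] = q - q^(i+1-s)\<close>, the next factor of
  \<open>qphi_coeff\<close>.\<close>

lemma qphi_coeff_eq:
  assumes q: "q > 0" "q \<noteq> 1" and "i \<le> s"
  shows "qfact q s * ((q - 1) ^ i * q powr (real i * (real i + 1) / 2 - real i * real s)
    / qfact q (s - i)) = qphi_coeff q s i"
  using \<open>i \<le> s\<close>
proof (induction i)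
  case 0
  then show ?case using q by (simp add: qfact_nonzero qphi_coeff_def)
next
  case (Suc i)
  let ?Q = "\<lambda>i. q powr (real i * (real i + 1) / 2 - real i * real s)"
    and ?w = "q powr (real i + 1 - real s)" and ?x = "qnum q (real (s - i))"
  have "s - i = Suc (s - Suc i)"
    using Suc.prems by simp
  then have fact: "qfact q (s - i) = ?x * qfact q (s - Suc i)"
    by (metis qfact_Suc)
  have x: "?x \<noteq> 0"
    using q Suc.prems by (simp add: qnum_eq_0_iff)
  have Q: "?Q (Suc i) = ?Q i * ?w"
    by (simp add: field_simps flip: powr_add)
  have "?w * q powr (real (s - i)) = q"
    using q Suc.prems by (simp add: of_nat_diff flip: powr_add)
  moreover have "(q - 1) * ?w * ?x = ?w * (q powr (real (s - i)) - 1)"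
    using q by (simp add: qnum_def)
  ultimately have w: "(q - 1) * ?w * ?x = q - ?w"
    by (simp only: right_diff_distrib mult_1_right)
  have "qfact q s * ((q - 1) ^ Suc i * ?Q (Suc i) / qfact q (s - Suc i)) =
      qfact q s * ((q - 1) ^ i * ?Q i / qfact q (s - i)) * ((q - 1) * ?w * ?x)"
    unfolding Q fact using x by simp
  also have "\<dots> = qphi_coeff q s i * (q - ?w)"
    unfolding w using Suc by simp
  finally show ?case
    unfolding qphi_coeff_Suc .
qed

text \<open>Induction on \<open>s\<close> through \<open>qphi_sum_recurrence\<close>; after an index
  shift, the coefficients of each \<open>1 / [k+i+1]\<close> combine by
  \<open>qphi_coeff_recurrence\<close>.\<close>

lemma qphi_sum_partial_fractions:
  assumes q: "q > 0" "q \<noteq> 1"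
  shows "qphi_sum q s k =
    q powr (- real s) * (\<Sum>i=0..s. qphi_coeff q s i / qnum q (real (k + i + 1)))"
proof (induction s arbitrary: k)
  case 0
  then show ?case using q by (simp add: qphi_sum_0 qphi_coeff_def)
next
  case (Suc s)
  let ?c = "qphi_coeff q s" and ?N = "\<lambda>i. qnum q (real (k + i + 1))"
  have N: "?N i \<noteq> 0" for i
    using q by (simp add: qnum_eq_0_iff)
  \<comment> \<open>\<open>q^(i+1) q^k = 1 + (q - 1) [k+i+1]\<close> removes \<open>q^k\<close> from
    the numerators; both quotients leave the same constant \<open>(q - 1) / q^(i+1)\<close>, which
    cancels.\<close>
  have split: "q ^ k / ?N i - (q ^ Suc k - 1) / ?N (Suc i) =
      1 / q ^ Suc i / ?N i + (1 - 1 / q ^ Suc i) / ?N (Suc i)" for i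
  proof -
    have "q ^ Suc i * q ^ k = 1 + (q - 1) * ?N i"
      and "q ^ Suc i * q ^ Suc k = 1 + (q - 1) * ?N (Suc i)"
      using q by (simp_all add: qnum_of_nat power_add del: of_nat_Suc of_nat_add)
    then have "q ^ k = 1 / q ^ Suc i + (q - 1) / q ^ Suc i * ?N i"
      and "q ^ Suc k = 1 / q ^ Suc i + (q - 1) / q ^ Suc i * ?N (Suc i)"
      using q by (simp_all add: field_simps del: power_Suc of_nat_Suc of_nat_add)
    then have "q ^ k / ?N i = 1 / q ^ Suc i / ?N i + (q - 1) / q ^ Suc i"
      and "q ^ Suc k / ?N (Suc i) = 1 / q ^ Suc i / ?N (Suc i) + (q - 1) / q ^ Suc i"
      using N[of i] N[of "Suc i"]
      by (simp_all only: add_divide_distrib nonzero_mult_div_cancel_right not_False_eq_True)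
    then show ?thesis
      by (simp only: diff_divide_distrib)
  qed
  have "qphi_sum q (Suc s) k = q powr (- real s) *
      (\<Sum>i=0..s. ?c i * (q ^ k / ?N i - (q ^ Suc k - 1) / ?N (Suc i)))"
    unfolding qphi_sum_recurrence[OF q] Suc.IH
    by (simp add: sum_distrib_left right_diff_distrib sum_subtractf mult_ac add_ac)
  also have "\<dots> = q powr (- real s) *
      ((\<Sum>i=0..s. ?c i / q ^ Suc i / ?N i) + (\<Sum>i=0..s. ?c i * (1 - 1 / q ^ Suc i) / ?N (Suc i)))"
    unfolding split by (simp add: distrib_left sum.distrib)
  \<comment> \<open>Appending the zero term \<open>i = Suc s\<close> lets the next index shift end
    in the range \<open>0..s\<close> of the other sum.\<close>
  also have "(\<Sum>i=0..s. ?c i / q ^ Suc i / ?N i) = (\<Sum>i=0..Suc s. ?c i / q ^ Suc i / ?N i)"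
    using q by (simp add: qphi_coeff_eq_0)
  also have "\<dots> = 1 / q / ?N 0 + (\<Sum>i=0..s. ?c (Suc i) / q ^ Suc (Suc i) / ?N (Suc i))"
    by (subst sum.atLeast0_atMost_Suc_shift) (simp add: qphi_coeff_def)
  also have "q powr (- real s) * (1 / q / ?N 0 +
        (\<Sum>i=0..s. ?c (Suc i) / q ^ Suc (Suc i) / ?N (Suc i)) +
        (\<Sum>i=0..s. ?c i * (1 - 1 / q ^ Suc i) / ?N (Suc i))) =
      q powr (- real s) * (1 / q / ?N 0 +
        (\<Sum>i=0..s. 1 / q * (qphi_coeff q (Suc s) (Suc i) / ?N (Suc i))))"
  proof -
    have "?c (Suc i) / q ^ Suc (Suc i) / ?N (Suc i) + ?c i * (1 - 1 / q ^ Suc i) / ?N (Suc i) =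
        1 / q * (qphi_coeff q (Suc s) (Suc i) / ?N (Suc i))" for i
    proof -
      have "?c (Suc i) / q ^ Suc (Suc i) + ?c i * (1 - 1 / q ^ Suc i) =
          1 / q * qphi_coeff q (Suc s) (Suc i)"
        using q by (simp add: qphi_coeff_recurrence field_simps)
      then show ?thesis
        by (metis add_divide_distrib times_divide_eq_right)
    qed
    then show ?thesis
      by (simp only: add.assoc flip: sum.distrib)
  qed
  also have "\<dots> = q powr (- real s) * (1 / q) *
      (\<Sum>i=0..Suc s. qphi_coeff q (Suc s) i / ?N i)"
    unfolding sum.atLeast0_atMost_Suc_shift sum_distrib_left[symmetric]
    by (simp add: qphi_coeff_def distrib_left)
  also have "q powr (- real s) * (1 / q) = q powr (- real (Suc s))"
    using q by (simp add: powr_diff powr_minus field_simps)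
  finally show ?case .
qed

lemma qphi_Suc_eq:
  assumes q: "q > 0" "q \<noteq> 1"
  shows "qphi q (Suc s) k = (- 1) ^ k * qfact q k * qfact q s * q powr (- real s) *
    (\<Sum>i=0..s. ((q - 1) ^ i * q powr (real i * (real i + 1) / 2 - real i * real s)
      / qfact q (s - i)) * (1 / qnum q (real k + real i + 1)))"
proof -
  have "(\<Sum>i=0..s. qphi_coeff q s i / qnum q (real (k + i + 1))) =
      qfact q s * (\<Sum>i=0..s. ((q - 1) ^ i * q powr (real i * (real i + 1) / 2 - real i * real s)
      / qfact q (s - i)) * (1 / qnum q (real k + real i + 1)))"
    unfolding sum_distrib_left
    by (intro sum.cong refl) (simp add: add_ac flip: qphi_coeff_eq[OF q])
  then show ?thesis
    unfolding qphi_Suc qphi_sum_partial_fractions[OF q] by (simp only: mult_ac)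
qed

section \<open>The step from \<open>r\<close> to \<open>r + 1\<close>, and the conclusion\<close>

lemma qphi_recurrence:
  assumes q: "q > 0" "q \<noteq> 1"
  shows "qphi q (Suc (Suc s)) k = q ^ k * qphi q (Suc s) k + (q - 1) * qphi q (Suc s) (Suc k)"
proof -
  \<comment> \<open>The factor \<open>[k+1]\<close> completes \<open>[k]!\<close> to
    \<open>[k+1]!\<close>, and the sign of \<open>(-1)^(k+1)\<close> turns the minus of
    \<open>qphi_sum_recurrence\<close> into a plus.\<close>
  have qnum: "q ^ Suc k - 1 = (q - 1) * qnum q (real (Suc k))"
    using q by (simp add: qnum_of_nat del: of_nat_Suc)
  show ?thesis
    unfolding qphi_Suc qphi_sum_recurrence[OF q] qfact_Suc qnum by (simp add: algebra_simps)
qed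

text \<open>At \<open>X = 0\<close> the factor \<open>q^(-X)\<close> is \<open>1\<close>. The
  induction is for all \<open>n\<close> at once, since the step also uses index
  \<open>n + 1\<close>.\<close>

lemma qbeta_Suc_eq_sum_qphi:
  assumes q: "q > 0" "q \<noteq> 1"
  shows "qbeta q (Suc s) n 0 = (\<Sum>k=0..n. qphi q (Suc s) k * qStirling2_rec q n k)"
proof (induction s arbitrary: n)
  case 0
  then show ?case
    using qbeta_1_eq_sum_qStirling2_rec[OF q, of n] by (simp add: qphi_Suc qphi_sum_0)
next
  case (Suc s)
  let ?p = "qphi q (Suc s)" and ?S = "qStirling2_rec q"
  have "qbeta q (Suc (Suc s)) n 0 = qbeta q (Suc s) n 0 + (q - 1) * qbeta q (Suc s) (Suc n) 0"
    using q by simp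
  also have "\<dots> = (\<Sum>k=0..n. ?p k * ?S n k + (q - 1) * ((?p (Suc k) + qnum q (real k) * ?p k) * ?S n k))"
    unfolding Suc.IH sum_qStirling2_rec_Suc sum.distrib sum_distrib_left ..
  also have "\<dots> = (\<Sum>k=0..n. qphi q (Suc (Suc s)) k * ?S n k)"
  proof (rule sum.cong[OF refl])
    fix k
    \<comment> \<open>The two contributions of \<open>?p k\<close>, namely \<open>1\<close> and
      \<open>(q - 1) [k]\<close>, add up to the \<open>q^k\<close> of
      \<open>qphi_recurrence\<close>.\<close>
    have power: "q ^ k = 1 + (q - 1) * qnum q (real k)"
      using q by (simp add: qnum_of_nat)
    show "?p k * ?S n k + (q - 1) * ((?p (Suc k) + qnum q (real k) * ?p k) * ?S n k) =
        qphi q (Suc (Suc s)) k * ?S n k"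
      unfolding qphi_recurrence[OF q] power by (simp add: algebra_simps)
  qed
  finally show ?case .
qed

theorem theorem2p23:
  fixes q :: real and r :: nat
  assumes "q > 0" and "q \<noteq> 1" and "r \<ge> 1"
  shows "(\<forall>n. qbeta q r n 0 = (\<Sum>k=0..n. qphi q r k * qStirling2 q n k)) \<and>
         (\<forall>k. qphi q r k =
            (-1) ^ k * qfact q k * qfact q (r - 1) * q powr (- real r + 1) *
            (\<Sum>i=0..r-1.
               ((q - 1) ^ i * q powr (real i * (real i + 1) / 2 - real i * (real r - 1))
                 / qfact q (r - 1 - i)) *
               (1 / qnum q (real k + real i + 1))))"
proof -
  obtain s where r: "r = Suc s"
    using \<open>r \<ge> 1\<close> by (cases r) auto
  have "- real (Suc s) + 1 = - real s" "real (Suc s) - 1 = real s"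
    by simp_all
  then show ?thesis
    unfolding r qStirling2_eq_rec[OF assms(1,2)] diff_Suc_1
    using qbeta_Suc_eq_sum_qphi[OF assms(1,2)] qphi_Suc_eq[OF assms(1,2)] by metis
qed

end
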